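(* Let $\mathbb{C}$ be a Cartesian differential category with a Conway operator $\mathbf{fix}$, and let $\mathbf{Tr}$ be the induced trace operator. Then $\mathbb{C}$ (with $\mathbf{fix}$) is a traced Cartesian differential category if and only if for every map $f:A\times X\to B\times X$, $$\mathbf{T}(\mathbf{Tr}^X_{A,B}(f))=\mathbf{Tr}^{\mathbf{T}X}_{\mathbf{T}A,\mathbf{T}B}(c\circ\mathbf{T}(f)\circ c)$$ (which means that $(\mathbf{T},c)$ is a traced monoidal functor, where the monoidal product is the cartesian product).
   Context: A left additive category is a category whose hom-sets are commutative monoids $(+,0)$ with $(f+g)\circ x=f\circ x+g\circ x$ and $0\circ x=0$. A map $f$ is additive if $f\circ(x+y)=f\circ x+f\circ y$ and $f\circ 0=0$. A Cartesian left additive category is a left additive category with finite products (terminal object $\top$, projections $\pi_j$, pairing $\langle -,\dots,-\rangle$) in which all projections are additive. A Cartesian differential category is a Cartesian left additive category $\mathbb{C}$ with a differential combinator: functions $\mathbf{D}:\mathbb{C}(A,B)\to\mathbb{C}(A\times A,B)$ such that: [CD.1] $\mathbf{D}[0]=0$, $\mathbf{D}[f+g]=\mathbf{D}[f]+\mathbf{D}[g]$; [CD.2] $\mathbf{D}[f]\circ\langle x,0\rangle=0$, $\mathbf{D}[f]\circ\langle x,y+z\rangle=\mathbf{D}[f]\circ\langle x,y\rangle+\mathbf{D}[f]\circ\langle x,z\rangle$; [CD.3] $\mathbf{D}[1_A]=\pi_2$, $\mathbf{D}[\pi_j]=\pi_j\circ\pi_2$; [CD.4] $\mathbf{D}[\langle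 f_1,\dots,f_n\rangle]=\langle\mathbf{D}[f_1],\dots,\mathbf{D}[f_n]\rangle$; [CD.5] $\mathbf{D}[g\circ f]=\mathbf{D}[g]\circ\langle f\circ\pi_1,\mathbf{D}[f]\rangle$; [CD.6] $\mathbf{D}[\mathbf{D}[f]]\circ\langle x,y,0,z\rangle=\mathbf{D}[f]\circ\langle x,z\rangle$; [CD.7] $\mathbf{D}[\mathbf{D}[f]]\circ\langle x,y,z,0\rangle=\mathbf{D}[\mathbf{D}[f]]\circ\langle x,z,y,0\rangle$. The tangent bundle functor $\mathbf{T}:\mathbb{C}\to\mathbb{C}$ is $\mathbf{T}(A)=A\times A$, $\mathbf{T}(f)=\langle f\circ\pi_1,\mathbf{D}[f]\rangle$. Write $c=\langle\pi_1,\pi_3,\pi_2,\pi_4\rangle:A\times B\times C\times D\to A\times C\times B\times D$ for the isomorphism swapping the middle two factors. A parametrized fixpoint operator on a category with finite products is a family of functions $\mathbf{fix}^X_A:\mathbb{C}(A\times X,X)\to\mathbb{C}(A,X)$ with (fixpoint axiom) $f\circ\langle 1_A,\mathbf{fix}^X_A(f)\rangle=\mathbf{fix}^X_A(f)$ for all $f:A\times X\to X$, and (naturality) $\mathbf{fix}^X_B(f)\circ g=\mathbf{fix}^X_A(f\circ(g\times 1_X))$ for all $g:A\to B$, $f:B\times X\to X$. A Conway operator is a parametrized fixpoint operator that also satisfies (dinaturality) $\mathbf{fix}^X_A(g\circ f)=g\circ\mathbf{fix}^Y_A(f\circ(1_A\times g))$ for all $f:A\times X\to Y$, $g:Y\to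 X$; and (Bekič) for all $f:A\times X\times Y\to X$, $g:A\times X\times Y\to Y$, $\mathbf{fix}^{X\times Y}_A(\langle f,g\rangle)=\langle l,\mathbf{fix}^Y_A(g\circ(\langle 1_A,l\rangle\times 1_Y))\rangle$ where $l=\mathbf{fix}^X_A\big(f\circ\langle 1_{A\times X},\mathbf{fix}^Y_{A\times X}(g)\rangle\big):A\to X$. The trace operator induced by a Conway operator is, for $f=\langle f_1,f_2\rangle:A\times X\to B\times X$ (so $f_1:A\times X\to B$, $f_2:A\times X\to X$), $\mathbf{Tr}^X_{A,B}(f)=f_1\circ\langle 1_A,\mathbf{fix}^X_A(f_2)\rangle:A\to B$. A traced Cartesian differential category is a Cartesian differential category with a Conway operator satisfying the differential-fixpoint rule: for every $f:A\times X\to X$, $\mathbf{D}[\mathbf{fix}^X_A(f)]=\pi_2\circ\mathbf{fix}^{\mathbf{T}X}_{\mathbf{T}A}(\mathbf{T}(f)\circ c)$. *)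

theory Defs
  imports Main
begin

section \<open>Categories with finite products\<close>

text \<open>
  Arrows carry a domain and a codomain, so distinct hom-sets are disjoint. All axioms are relative
  to the carriers \<open>Ob\<close> and \<open>Ar\<close>; operations are unspecified on arguments outside them.
\<close>

record ('o, 'm) cat =
  Ob :: "'o set"
  Ar :: "'m set"
  dom :: "'m \<Rightarrow> 'o"
  cod :: "'m \<Rightarrow> 'o"
  idt :: "'o \<Rightarrow> 'm" ("\<one>\<index>")
  comp :: "'m \<Rightarrow> 'm \<Rightarrow> 'm" (infixl "\<cdot>\<index>" 70)

definition hom :: "('o, 'm, 'r) cat_scheme \<Rightarrow> 'o \<Rightarrow> 'o \<Rightarrow> 'm set" where
  "hom C A B = {f \<in> Ar C. dom C f = A \<and> cod C f = B}"

locale category =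
  fixes C :: "('o, 'm, 'r) cat_scheme" (structure)
  assumes dom_Ob: "f \<in> Ar C \<Longrightarrow> dom C f \<in> Ob C"
    and cod_Ob: "f \<in> Ar C \<Longrightarrow> cod C f \<in> Ob C"
    and id_hom: "A \<in> Ob C \<Longrightarrow> \<one> A \<in> hom C A A"
    and comp_hom: "f \<in> hom C A B \<Longrightarrow> g \<in> hom C B B' \<Longrightarrow> g \<cdot> f \<in> hom C A B'"
    and comp_assoc: "f \<in> hom C A B \<Longrightarrow> g \<in> hom C B B' \<Longrightarrow> h \<in> hom C B' B'' \<Longrightarrow>
          h \<cdot> g \<cdot> f = h \<cdot> (g \<cdot> f)"
    and id_left: "f \<in> hom C A B \<Longrightarrow> \<one> B \<cdot> f = f"
    and id_right: "f \<in> hom C A B \<Longrightarrow> f \<cdot> \<one> A = f"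

definition inverse_arrows :: "('o, 'm, 'r) cat_scheme \<Rightarrow> 'm \<Rightarrow> 'm \<Rightarrow> bool" where
  "inverse_arrows C f g \<longleftrightarrow> f \<in> Ar C \<and> g \<in> hom C (cod C f) (dom C f) \<and>
     comp C g f = idt C (dom C f) \<and> comp C f g = idt C (cod C f)"

text \<open>
  Finite products are given by a chosen terminal object \<open>top\<close> and chosen binary products.
  A product \<open>A \<times> X \<times> Y\<close> is bracketed to the left, as \<open>(A \<otimes> X) \<otimes> Y\<close>. Products of products, such as
  \<open>(A \<otimes> A) \<otimes> (A \<otimes> A)\<close> for two applications of the tangent functor, keep their bracketing, and a
  quadruple \<open>\<langle>x, y, z, w\<rangle>\<close> into one is \<open>\<langle>\<langle>x, y\<rangle>, \<langle>z, w\<rangle>\<rangle>\<close>.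
\<close>

record ('o, 'm) cart_cat = "('o, 'm) cat" +
  top :: "'o" ("\<top>\<index>")
  bang :: "'o \<Rightarrow> 'm" ("!\<index>")
  prd :: "'o \<Rightarrow> 'o \<Rightarrow> 'o" (infixl "\<otimes>\<index>" 75)
  pr1 :: "'o \<Rightarrow> 'o \<Rightarrow> 'm" ("\<pi>1\<index>")
  pr2 :: "'o \<Rightarrow> 'o \<Rightarrow> 'm" ("\<pi>2\<index>")
  pairing :: "'m \<Rightarrow> 'm \<Rightarrow> 'm" ("(\<langle>_,/ _\<rangle>\<index>)")

locale cartesian_category = category C
  for C :: "('o, 'm, 'r) cart_cat_scheme" (structure) +
  assumes top_Ob: "\<top> \<in> Ob C"
    and bang_hom: "A \<in> Ob C \<Longrightarrow> ! A \<in> hom C A \<top>"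
    and bang_unique: "f \<in> hom C A \<top> \<Longrightarrow> f = ! A"
    and prd_Ob: "A \<in> Ob C \<Longrightarrow> B \<in> Ob C \<Longrightarrow> A \<otimes> B \<in> Ob C"
    and pr1_hom: "A \<in> Ob C \<Longrightarrow> B \<in> Ob C \<Longrightarrow> \<pi>1 A B \<in> hom C (A \<otimes> B) A"
    and pr2_hom: "A \<in> Ob C \<Longrightarrow> B \<in> Ob C \<Longrightarrow> \<pi>2 A B \<in> hom C (A \<otimes> B) B"
    and pair_hom: "f \<in> hom C Z A \<Longrightarrow> g \<in> hom C Z B \<Longrightarrow> \<langle>f, g\<rangle> \<in> hom C Z (A \<otimes> B)"
    and pr1_pair: "f \<in> hom C Z A \<Longrightarrow> g \<in> hom C Z B \<Longrightarrow> \<pi>1 A B \<cdot> \<langle>f, g\<rangle> = f"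
    and pr2_pair: "f \<in> hom C Z A \<Longrightarrow> g \<in> hom C Z B \<Longrightarrow> \<pi>2 A B \<cdot> \<langle>f, g\<rangle> = g"
    and pair_unique: "A \<in> Ob C \<Longrightarrow> B \<in> Ob C \<Longrightarrow> h \<in> hom C Z (A \<otimes> B) \<Longrightarrow>
          \<pi>1 A B \<cdot> h = f \<Longrightarrow> \<pi>2 A B \<cdot> h = g \<Longrightarrow> h = \<langle>f, g\<rangle>"

definition prd_map :: "('o, 'm, 'r) cart_cat_scheme \<Rightarrow> 'm \<Rightarrow> 'm \<Rightarrow> 'm" (infixl "\<boxtimes>\<index>" 75) where
  "f \<boxtimes>\<^bsub>C\<^esub> g = \<langle>f \<cdot>\<^bsub>C\<^esub> \<pi>1\<^bsub>C\<^esub> (dom C f) (dom C g), g \<cdot>\<^bsub>C\<^esub> \<pi>2\<^bsub>C\<^esub> (dom C f) (dom C g)\<rangle>\<^bsub>C\<^esub>"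

definition assoc :: "('o, 'm, 'r) cart_cat_scheme \<Rightarrow> 'o \<Rightarrow> 'o \<Rightarrow> 'o \<Rightarrow> 'm" where
  "assoc C X Y Z =
     \<langle>\<pi>1\<^bsub>C\<^esub> X Y \<cdot>\<^bsub>C\<^esub> \<pi>1\<^bsub>C\<^esub> (X \<otimes>\<^bsub>C\<^esub> Y) Z,
      \<langle>\<pi>2\<^bsub>C\<^esub> X Y \<cdot>\<^bsub>C\<^esub> \<pi>1\<^bsub>C\<^esub> (X \<otimes>\<^bsub>C\<^esub> Y) Z, \<pi>2\<^bsub>C\<^esub> (X \<otimes>\<^bsub>C\<^esub> Y) Z\<rangle>\<^bsub>C\<^esub>\<rangle>\<^bsub>C\<^esub>"

definition assoc_inv :: "('o, 'm, 'r) cart_cat_scheme \<Rightarrow> 'o \<Rightarrow> 'o \<Rightarrow> 'o \<Rightarrow> 'm" where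
  "assoc_inv C X Y Z =
     \<langle>\<langle>\<pi>1\<^bsub>C\<^esub> X (Y \<otimes>\<^bsub>C\<^esub> Z), \<pi>1\<^bsub>C\<^esub> Y Z \<cdot>\<^bsub>C\<^esub> \<pi>2\<^bsub>C\<^esub> X (Y \<otimes>\<^bsub>C\<^esub> Z)\<rangle>\<^bsub>C\<^esub>,
      \<pi>2\<^bsub>C\<^esub> Y Z \<cdot>\<^bsub>C\<^esub> \<pi>2\<^bsub>C\<^esub> X (Y \<otimes>\<^bsub>C\<^esub> Z)\<rangle>\<^bsub>C\<^esub>"

definition symm :: "('o, 'm, 'r) cart_cat_scheme \<Rightarrow> 'o \<Rightarrow> 'o \<Rightarrow> 'm" where
  "symm C X Y = \<langle>\<pi>2\<^bsub>C\<^esub> X Y, \<pi>1\<^bsub>C\<^esub> X Y\<rangle>\<^bsub>C\<^esub>"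

text \<open>The swap \<open>c : (X \<otimes> Y) \<otimes> (Z \<otimes> W) \<rightarrow> (X \<otimes> Z) \<otimes> (Y \<otimes> W)\<close> of the middle two factors.\<close>

definition swap_mid :: "('o, 'm, 'r) cart_cat_scheme \<Rightarrow> 'o \<Rightarrow> 'o \<Rightarrow> 'o \<Rightarrow> 'o \<Rightarrow> 'm" where
  "swap_mid C X Y Z W =
    (let p = \<pi>1\<^bsub>C\<^esub> (X \<otimes>\<^bsub>C\<^esub> Y) (Z \<otimes>\<^bsub>C\<^esub> W);
         q = \<pi>2\<^bsub>C\<^esub> (X \<otimes>\<^bsub>C\<^esub> Y) (Z \<otimes>\<^bsub>C\<^esub> W)
     in \<langle>\<langle>\<pi>1\<^bsub>C\<^esub> X Y \<cdot>\<^bsub>C\<^esub> p, \<pi>1\<^bsub>C\<^esub> Z W \<cdot>\<^bsub>C\<^esub> q\<rangle>\<^bsub>C\<^esub>, \<langle>\<pi>2\<^bsub>C\<^esub> X Y \<cdot>\<^bsub>C\<^esub> p, \<pi>2\<^bsub>C\<^esub> Z W \<cdot>\<^bsub>C\<^esub> q\<rangle>\<^bsub>C\<^esub>\<rangle>\<^bsub>C\<^esub>)"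


section \<open>Cartesian differential categories\<close>

record ('o, 'm) cart_add_cat = "('o, 'm) cart_cat" +
  zro :: "'o \<Rightarrow> 'o \<Rightarrow> 'm" ("\<zero>\<index>")
  add :: "'m \<Rightarrow> 'm \<Rightarrow> 'm" (infixl "\<oplus>\<index>" 65)

locale left_additive_category = category C
  for C :: "('o, 'm, 'r) cart_add_cat_scheme" (structure) +
  assumes zero_hom: "A \<in> Ob C \<Longrightarrow> B \<in> Ob C \<Longrightarrow> \<zero> A B \<in> hom C A B"
    and add_hom: "f \<in> hom C A B \<Longrightarrow> g \<in> hom C A B \<Longrightarrow> f \<oplus> g \<in> hom C A B"
    and add_assoc: "f \<in> hom C A B \<Longrightarrow> g \<in> hom C A B \<Longrightarrow> h \<in> hom C A B \<Longrightarrow>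
          (f \<oplus> g) \<oplus> h = f \<oplus> (g \<oplus> h)"
    and add_commute: "f \<in> hom C A B \<Longrightarrow> g \<in> hom C A B \<Longrightarrow> f \<oplus> g = g \<oplus> f"
    and zero_add: "f \<in> hom C A B \<Longrightarrow> \<zero> A B \<oplus> f = f"
    and add_comp: "x \<in> hom C Z A \<Longrightarrow> f \<in> hom C A B \<Longrightarrow> g \<in> hom C A B \<Longrightarrow>
          (f \<oplus> g) \<cdot> x = f \<cdot> x \<oplus> g \<cdot> x"
    and zero_comp: "x \<in> hom C Z A \<Longrightarrow> B \<in> Ob C \<Longrightarrow> \<zero> A B \<cdot> x = \<zero> Z B"

definition additive :: "('o, 'm, 'r) cart_add_cat_scheme \<Rightarrow> 'm \<Rightarrow> bool" where
  "additive C f \<longleftrightarrow> f \<in> Ar C \<and>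
     (\<forall>Z \<in> Ob C. \<forall>x \<in> hom C Z (dom C f). \<forall>y \<in> hom C Z (dom C f).
        f \<cdot>\<^bsub>C\<^esub> (x \<oplus>\<^bsub>C\<^esub> y) = f \<cdot>\<^bsub>C\<^esub> x \<oplus>\<^bsub>C\<^esub> f \<cdot>\<^bsub>C\<^esub> y) \<and>
     (\<forall>Z \<in> Ob C. f \<cdot>\<^bsub>C\<^esub> \<zero>\<^bsub>C\<^esub> Z (dom C f) = \<zero>\<^bsub>C\<^esub> Z (cod C f))"

locale cartesian_left_additive_category = left_additive_category C + cartesian_category C
  for C :: "('o, 'm, 'r) cart_add_cat_scheme" (structure) +
  assumes pr1_additive: "A \<in> Ob C \<Longrightarrow> B \<in> Ob C \<Longrightarrow> additive C (\<pi>1 A B)"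
    and pr2_additive: "A \<in> Ob C \<Longrightarrow> B \<in> Ob C \<Longrightarrow> additive C (\<pi>2 A B)"

record ('o, 'm) diff_cat = "('o, 'm) cart_add_cat" +
  dcomb :: "'m \<Rightarrow> 'm" ("\<D>\<index>")

text \<open>
  It suffices to ask \<open>CD3\<close> and \<open>CD4\<close> for binary products: longer projections and tuples are
  composites of these, and the empty tuple is preserved because \<open>\<top>\<close> is terminal.
\<close>

locale cartesian_differential_category = cartesian_left_additive_category C
  for C :: "('o, 'm, 'r) diff_cat_scheme" (structure) +
  assumes D_hom: "f \<in> hom C A B \<Longrightarrow> \<D> f \<in> hom C (A \<otimes> A) B"
    and CD1_zero: "A \<in> Ob C \<Longrightarrow> B \<in> Ob C \<Longrightarrow> \<D> (\<zero> A B) = \<zero> (A \<otimes> A) B"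
    and CD1_add: "f \<in> hom C A B \<Longrightarrow> g \<in> hom C A B \<Longrightarrow> \<D> (f \<oplus> g) = \<D> f \<oplus> \<D> g"
    and CD2_zero: "f \<in> hom C A B \<Longrightarrow> x \<in> hom C Z A \<Longrightarrow> \<D> f \<cdot> \<langle>x, \<zero> Z A\<rangle> = \<zero> Z B"
    and CD2_add: "f \<in> hom C A B \<Longrightarrow> x \<in> hom C Z A \<Longrightarrow> y \<in> hom C Z A \<Longrightarrow> z \<in> hom C Z A \<Longrightarrow>
          \<D> f \<cdot> \<langle>x, y \<oplus> z\<rangle> = \<D> f \<cdot> \<langle>x, y\<rangle> \<oplus> \<D> f \<cdot> \<langle>x, z\<rangle>"
    and CD3_id: "A \<in> Ob C \<Longrightarrow> \<D> (\<one> A) = \<pi>2 A A"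
    and CD3_pr1: "A \<in> Ob C \<Longrightarrow> B \<in> Ob C \<Longrightarrow>
          \<D> (\<pi>1 A B) = \<pi>1 A B \<cdot> \<pi>2 (A \<otimes> B) (A \<otimes> B)"
    and CD3_pr2: "A \<in> Ob C \<Longrightarrow> B \<in> Ob C \<Longrightarrow>
          \<D> (\<pi>2 A B) = \<pi>2 A B \<cdot> \<pi>2 (A \<otimes> B) (A \<otimes> B)"
    and CD4: "f \<in> hom C Z A \<Longrightarrow> g \<in> hom C Z B \<Longrightarrow> \<D> \<langle>f, g\<rangle> = \<langle>\<D> f, \<D> g\<rangle>"
    and CD5: "f \<in> hom C A B \<Longrightarrow> g \<in> hom C B B' \<Longrightarrow> \<D> (g \<cdot> f) = \<D> g \<cdot> \<langle>f \<cdot> \<pi>1 A A, \<D> f\<rangle>"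
    and CD6: "f \<in> hom C A B \<Longrightarrow> x \<in> hom C Z A \<Longrightarrow> y \<in> hom C Z A \<Longrightarrow> z \<in> hom C Z A \<Longrightarrow>
          \<D> (\<D> f) \<cdot> \<langle>\<langle>x, y\<rangle>, \<langle>\<zero> Z A, z\<rangle>\<rangle> = \<D> f \<cdot> \<langle>x, z\<rangle>"
    and CD7: "f \<in> hom C A B \<Longrightarrow> x \<in> hom C Z A \<Longrightarrow> y \<in> hom C Z A \<Longrightarrow> z \<in> hom C Z A \<Longrightarrow>
          \<D> (\<D> f) \<cdot> \<langle>\<langle>x, y\<rangle>, \<langle>z, \<zero> Z A\<rangle>\<rangle> = \<D> (\<D> f) \<cdot> \<langle>\<langle>x, z\<rangle>, \<langle>y, \<zero> Z A\<rangle>\<rangle>"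

definition T_ob :: "('o, 'm, 'r) diff_cat_scheme \<Rightarrow> 'o \<Rightarrow> 'o" where
  "T_ob C A = A \<otimes>\<^bsub>C\<^esub> A"

definition T_map :: "('o, 'm, 'r) diff_cat_scheme \<Rightarrow> 'm \<Rightarrow> 'm" where
  "T_map C f = \<langle>f \<cdot>\<^bsub>C\<^esub> \<pi>1\<^bsub>C\<^esub> (dom C f) (dom C f), \<D>\<^bsub>C\<^esub> f\<rangle>\<^bsub>C\<^esub>"


section \<open>Conway operators and traces\<close>

text \<open>
  \<open>fx A X\<close> is the operator \<open>fix\<close> with parameter object \<open>A\<close> and fixpoint object \<open>X\<close>; both are
  explicit since they need not be determined by \<open>A \<otimes> X\<close>.
\<close>

locale parametrized_fixpoint_operator = cartesian_category C
  for C :: "('o, 'm, 'r) cart_cat_scheme" (structure)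
    and fx :: "'o \<Rightarrow> 'o \<Rightarrow> 'm \<Rightarrow> 'm" +
  assumes fix_hom: "A \<in> Ob C \<Longrightarrow> X \<in> Ob C \<Longrightarrow> f \<in> hom C (A \<otimes> X) X \<Longrightarrow> fx A X f \<in> hom C A X"
    and fixpoint: "A \<in> Ob C \<Longrightarrow> X \<in> Ob C \<Longrightarrow> f \<in> hom C (A \<otimes> X) X \<Longrightarrow>
          f \<cdot> \<langle>\<one> A, fx A X f\<rangle> = fx A X f"
    and naturality: "X \<in> Ob C \<Longrightarrow> g \<in> hom C A B \<Longrightarrow> f \<in> hom C (B \<otimes> X) X \<Longrightarrow>
          fx B X f \<cdot> g = fx A X (f \<cdot> (g \<boxtimes> \<one> X))"

text \<open>
  In \<open>bekic\<close>, precomposing with \<open>assoc_inv C A X Y\<close> turns \<open>\<langle>f, g\<rangle>\<close>, whose domain is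
  \<open>(A \<otimes> X) \<otimes> Y\<close>, into an arrow with domain \<open>A \<otimes> (X \<otimes> Y)\<close>.
\<close>

locale conway_operator = parametrized_fixpoint_operator C fx
  for C :: "('o, 'm, 'r) cart_cat_scheme" (structure)
    and fx :: "'o \<Rightarrow> 'o \<Rightarrow> 'm \<Rightarrow> 'm" +
  assumes dinaturality: "A \<in> Ob C \<Longrightarrow> X \<in> Ob C \<Longrightarrow> f \<in> hom C (A \<otimes> X) Y \<Longrightarrow> g \<in> hom C Y X \<Longrightarrow>
          fx A X (g \<cdot> f) = g \<cdot> fx A Y (f \<cdot> (\<one> A \<boxtimes> g))"
    and bekic: "A \<in> Ob C \<Longrightarrow> X \<in> Ob C \<Longrightarrow> Y \<in> Ob C \<Longrightarrow>
          f \<in> hom C (A \<otimes> X \<otimes> Y) X \<Longrightarrow> g \<in> hom C (A \<otimes> X \<otimes> Y) Y \<Longrightarrow>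
          l = fx A X (f \<cdot> \<langle>\<one> (A \<otimes> X), fx (A \<otimes> X) Y g\<rangle>) \<Longrightarrow>
          fx A (X \<otimes> Y) (\<langle>f, g\<rangle> \<cdot> assoc_inv C A X Y) =
            \<langle>l, fx A Y (g \<cdot> (\<langle>\<one> A, l\<rangle> \<boxtimes> \<one> Y))\<rangle>"

text \<open>The trace of \<open>f : A \<otimes> X \<rightarrow> B \<otimes> X\<close> along \<open>X\<close>.\<close>

definition conway_trace ::
    "('o, 'm, 'r) cart_cat_scheme \<Rightarrow> ('o \<Rightarrow> 'o \<Rightarrow> 'm \<Rightarrow> 'm) \<Rightarrow> 'o \<Rightarrow> 'o \<Rightarrow> 'o \<Rightarrow> 'm \<Rightarrow> 'm" where
  "conway_trace C fx A B X f =
     (\<pi>1\<^bsub>C\<^esub> B X \<cdot>\<^bsub>C\<^esub> f) \<cdot>\<^bsub>C\<^esub> \<langle>\<one>\<^bsub>C\<^esub> A, fx A X (\<pi>2\<^bsub>C\<^esub> B X \<cdot>\<^bsub>C\<^esub> f)\<rangle>\<^bsub>C\<^esub>"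

locale traced_cartesian_differential_category =
  cartesian_differential_category C + conway_operator C fx
  for C :: "('o, 'm, 'r) diff_cat_scheme" (structure)
    and fx :: "'o \<Rightarrow> 'o \<Rightarrow> 'm \<Rightarrow> 'm" +
  assumes differential_fixpoint: "A \<in> Ob C \<Longrightarrow> X \<in> Ob C \<Longrightarrow> f \<in> hom C (A \<otimes> X) X \<Longrightarrow>
          \<D> (fx A X f) = \<pi>2 X X \<cdot> fx (T_ob C A) (T_ob C X) (T_map C f \<cdot> swap_mid C A A X X)"


section \<open>Traced monoidal endofunctors for the cartesian monoidal structure\<close>

locale endofunctor = category C
  for C :: "('o, 'm, 'r) cat_scheme" (structure)
    and Fo :: "'o \<Rightarrow> 'o" and Fm :: "'m \<Rightarrow> 'm" +
  assumes functor_Ob: "A \<in> Ob C \<Longrightarrow> Fo A \<in> Ob C"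
    and functor_hom: "f \<in> hom C A B \<Longrightarrow> Fm f \<in> hom C (Fo A) (Fo B)"
    and functor_id: "A \<in> Ob C \<Longrightarrow> Fm (\<one> A) = \<one> (Fo A)"
    and functor_comp: "f \<in> hom C A B \<Longrightarrow> g \<in> hom C B B' \<Longrightarrow> Fm (g \<cdot> f) = Fm g \<cdot> Fm f"

text \<open>
  Strong symmetric monoidal endofunctors with comparison isomorphisms
  \<open>m A B : Fo A \<otimes> Fo B \<rightarrow> Fo (A \<otimes> B)\<close> and \<open>m0 : \<top> \<rightarrow> Fo \<top>\<close>. The unitors of the cartesian
  monoidal structure are \<open>\<pi>2 \<top> A\<close> and \<open>\<pi>1 A \<top>\<close>.
\<close>

locale symmetric_monoidal_endofunctor = cartesian_category C + endofunctor C Fo Fm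
  for C :: "('o, 'm, 'r) cart_cat_scheme" (structure)
    and Fo :: "'o \<Rightarrow> 'o" and Fm :: "'m \<Rightarrow> 'm"
    and m :: "'o \<Rightarrow> 'o \<Rightarrow> 'm" and m0 :: "'m" +
  assumes m_hom: "A \<in> Ob C \<Longrightarrow> B \<in> Ob C \<Longrightarrow> m A B \<in> hom C (Fo A \<otimes> Fo B) (Fo (A \<otimes> B))"
    and m_iso: "A \<in> Ob C \<Longrightarrow> B \<in> Ob C \<Longrightarrow> \<exists>n. inverse_arrows C (m A B) n"
    and m0_hom: "m0 \<in> hom C \<top> (Fo \<top>)"
    and m0_iso: "\<exists>n. inverse_arrows C m0 n"
    and m_natural: "f \<in> hom C A A' \<Longrightarrow> g \<in> hom C B B' \<Longrightarrow>
          Fm (f \<boxtimes> g) \<cdot> m A B = m A' B' \<cdot> (Fm f \<boxtimes> Fm g)"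
    and m_assoc: "X \<in> Ob C \<Longrightarrow> Y \<in> Ob C \<Longrightarrow> Z \<in> Ob C \<Longrightarrow>
          Fm (assoc C X Y Z) \<cdot> (m (X \<otimes> Y) Z \<cdot> (m X Y \<boxtimes> \<one> (Fo Z))) =
          m X (Y \<otimes> Z) \<cdot> ((\<one> (Fo X) \<boxtimes> m Y Z) \<cdot> assoc C (Fo X) (Fo Y) (Fo Z))"
    and m_left_unit: "A \<in> Ob C \<Longrightarrow> Fm (\<pi>2 \<top> A) \<cdot> (m \<top> A \<cdot> (m0 \<boxtimes> \<one> (Fo A))) = \<pi>2 \<top> (Fo A)"
    and m_right_unit: "A \<in> Ob C \<Longrightarrow> Fm (\<pi>1 A \<top>) \<cdot> (m A \<top> \<cdot> (\<one> (Fo A) \<boxtimes> m0)) = \<pi>1 (Fo A) \<top>"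
    and m_symm: "A \<in> Ob C \<Longrightarrow> B \<in> Ob C \<Longrightarrow> Fm (symm C A B) \<cdot> m A B = m B A \<cdot> symm C (Fo A) (Fo B)"

locale traced_monoidal_endofunctor = symmetric_monoidal_endofunctor C Fo Fm m m0
  for C :: "('o, 'm, 'r) cart_cat_scheme" (structure)
    and tr :: "'o \<Rightarrow> 'o \<Rightarrow> 'o \<Rightarrow> 'm \<Rightarrow> 'm"
    and Fo :: "'o \<Rightarrow> 'o" and Fm :: "'m \<Rightarrow> 'm"
    and m :: "'o \<Rightarrow> 'o \<Rightarrow> 'm" and m0 :: "'m" +
  assumes preserves_trace: "A \<in> Ob C \<Longrightarrow> B \<in> Ob C \<Longrightarrow> X \<in> Ob C \<Longrightarrow> f \<in> hom C (A \<otimes> X) (B \<otimes> X) \<Longrightarrow>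
          inverse_arrows C (m B X) n \<Longrightarrow>
          Fm (tr A B X f) = tr (Fo A) (Fo B) (Fo X) (n \<cdot> (Fm f \<cdot> m A X))"

end

theory Submission
  imports Defs
begin

text \<open>
  The tangent functor \<open>T\<close> preserves finite products, with the swap of the middle factors as
  comparison. The theorem then combines two observations.

  The first holds for every product-preserving endofunctor \<open>F\<close> with comparison \<open>m\<close>. Such a functor
  is symmetric monoidal (\<open>symmetric_monoidal\<close>), and it preserves the trace if and only if it
  preserves fixpoints, \<open>F (fix f) = fix (F f \<cdot> m)\<close> (\<open>preserves_trace_iff_preserves_fix\<close>). Indeed the
  trace of \<open>f = \<langle>f\<^sub>1, f\<^sub>2\<rangle>\<close> is \<open>f\<^sub>1 \<cdot> \<langle>\<one>, fix f\<^sub>2\<rangle>\<close>, built from \<open>fix\<close> by composition and pairing only;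
  conversely \<open>fix f\<close> is the trace of \<open>\<langle>f, f\<rangle>\<close>, by the fixpoint axiom.

  The second is special to \<open>T\<close>. Both \<open>T (fix f)\<close> and \<open>fix (T f \<cdot> c)\<close> are arrows into a product
  \<open>X \<otimes> X\<close>, so to compare them is to compare their two components. The differential-fixpoint rule is
  the equality of the second components. The first components always agree: the first component of
  \<open>T f \<cdot> c\<close> does not involve the tangent variables, so the system that \<open>fix (T f \<cdot> c)\<close> solves is
  triangular, and the Bekic law solves the base variable separately (\<open>fix_triangular\<close>).
\<close>

section \<open>Calculating in a category with finite products\<close>

text \<open>
  The simplification rules below speak of \<open>dom\<close> and \<open>cod\<close> instead of \<open>hom\<close>, so that
  every side condition is determined by the arrows themselves. They bring a composite into a normal
  form: composition bracketed to the right, pairs outermost, projections cancelled against pairs.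
\<close>

context category
begin

declare dom_Ob [simp] cod_Ob [simp]

lemma comp_arrow [simp]:
  assumes "f \<in> Ar C" "g \<in> Ar C" "dom C g = cod C f"
  shows "g \<cdot> f \<in> Ar C" "dom C (g \<cdot> f) = dom C f" "cod C (g \<cdot> f) = cod C g"
  using comp_hom[of f "dom C f" "cod C f" g "cod C g"] assms by (auto simp: hom_def)

lemma id_arrow [simp]:
  assumes "A \<in> Ob C"
  shows "\<one> A \<in> Ar C" "dom C (\<one> A) = A" "cod C (\<one> A) = A"
  using id_hom[OF assms] by (auto simp: hom_def)

lemma comp_assoc_right [simp]:
  assumes "f \<in> Ar C" "g \<in> Ar C" "h \<in> Ar C" "dom C g = cod C f" "dom C h = cod C g"
  shows "h \<cdot> g \<cdot> f = h \<cdot> (g \<cdot> f)"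
  using comp_assoc[of f "dom C f" "cod C f" g "cod C g" h "cod C h"] assms by (auto simp: hom_def)

lemma id_comp [simp]: "f \<in> Ar C \<Longrightarrow> cod C f = B \<Longrightarrow> \<one> B \<cdot> f = f"
  using id_left[of f "dom C f" B] by (auto simp: hom_def)

lemma comp_id [simp]: "f \<in> Ar C \<Longrightarrow> dom C f = A \<Longrightarrow> f \<cdot> \<one> A = f"
  using id_right[of f A "cod C f"] by (auto simp: hom_def)

lemma inverse_arrows_unique:
  assumes "inverse_arrows C f g" "inverse_arrows C f h"
  shows "g = h"
proof -
  have *: "f \<in> Ar C" "g \<in> Ar C" "h \<in> Ar C" "dom C g = cod C f" "cod C g = dom C f"
    "dom C h = cod C f" "cod C h = dom C f"
    "g \<cdot> f = \<one> (dom C f)" "f \<cdot> h = \<one> (cod C f)"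
    using assms by (auto simp: inverse_arrows_def hom_def)
  have "g = g \<cdot> (f \<cdot> h)" using * by simp
  also have "\<dots> = g \<cdot> f \<cdot> h" using * by (subst comp_assoc_right) auto
  also have "\<dots> = h" using * by simp
  finally show ?thesis .
qed

end

context cartesian_category
begin

declare top_Ob [simp] prd_Ob [simp]

lemma bang_arrow [simp]:
  assumes "A \<in> Ob C"
  shows "! A \<in> Ar C" "dom C (! A) = A" "cod C (! A) = \<top>"
  using bang_hom[OF assms] by (auto simp: hom_def)

lemma to_top_eqI: "f \<in> hom C A \<top> \<Longrightarrow> g \<in> hom C A \<top> \<Longrightarrow> f = g"
  using bang_unique by metis

lemma pr_arrow [simp]:
  assumes "A \<in> Ob C" "B \<in> Ob C"
  shows "\<pi>1 A B \<in> Ar C" "dom C (\<pi>1 A B) = A \<otimes> B" "cod C (\<pi>1 A B) = A"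
    "\<pi>2 A B \<in> Ar C" "dom C (\<pi>2 A B) = A \<otimes> B" "cod C (\<pi>2 A B) = B"
  using pr1_hom[OF assms] pr2_hom[OF assms] by (auto simp: hom_def)

lemma pair_arrow [simp]:
  assumes "f \<in> Ar C" "g \<in> Ar C" "dom C f = dom C g"
  shows "\<langle>f, g\<rangle> \<in> Ar C" "dom C \<langle>f, g\<rangle> = dom C g" "cod C \<langle>f, g\<rangle> = cod C f \<otimes> cod C g"
  using pair_hom[of f "dom C g" "cod C f" g "cod C g"] assms by (auto simp: hom_def)

lemma pr_pair [simp]:
  assumes "f \<in> Ar C" "g \<in> Ar C" "dom C f = dom C g" "cod C f = A" "cod C g = B"
  shows "\<pi>1 A B \<cdot> \<langle>f, g\<rangle> = f" "\<pi>2 A B \<cdot> \<langle>f, g\<rangle> = g"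
  using pr1_pair[of f "dom C g" A g B] pr2_pair[of f "dom C g" A g B] assms
  by (auto simp: hom_def)

lemma pair_pr [simp]:
  assumes "A \<in> Ob C" "B \<in> Ob C"
  shows "h \<in> Ar C \<Longrightarrow> cod C h = A \<otimes> B \<Longrightarrow> \<langle>\<pi>1 A B \<cdot> h, \<pi>2 A B \<cdot> h\<rangle> = h"
    and "\<langle>\<pi>1 A B, \<pi>2 A B\<rangle> = \<one> (A \<otimes> B)"
  using pair_unique[of A B h "dom C h"] pair_unique[of A B "\<one> (A \<otimes> B)" "A \<otimes> B"] assms
  by (auto simp: hom_def)

lemma product_eqI:
  assumes "A \<in> Ob C" "B \<in> Ob C" "f \<in> hom C Z (A \<otimes> B)" "g \<in> hom C Z (A \<otimes> B)"
    "\<pi>1 A B \<cdot> f = \<pi>1 A B \<cdot> g" "\<pi>2 A B \<cdot> f = \<pi>2 A B \<cdot> g"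
  shows "f = g"
  using pair_unique[OF assms(1,2,3,5,6)] pair_unique[OF assms(1,2,4) refl refl] by simp

lemma pair_comp [simp]:
  assumes "f \<in> Ar C" "g \<in> Ar C" "h \<in> Ar C" "dom C f = cod C h" "dom C g = cod C h"
  shows "\<langle>f, g\<rangle> \<cdot> h = \<langle>f \<cdot> h, g \<cdot> h\<rangle>"
proof -
  have 1: "\<pi>1 (cod C f) (cod C g) \<cdot> (\<langle>f, g\<rangle> \<cdot> h) = f \<cdot> h"
    using assms by (subst comp_assoc_right[symmetric]) auto
  have 2: "\<pi>2 (cod C f) (cod C g) \<cdot> (\<langle>f, g\<rangle> \<cdot> h) = g \<cdot> h"
    using assms by (subst comp_assoc_right[symmetric]) auto
  show ?thesis
    using pair_unique[OF _ _ _ 1 2, of "dom C h"] assms by (auto simp: hom_def)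
qed

end


section \<open>Product-preserving endofunctors\<close>

text \<open>
  The comparison \<open>m A B\<close> is required to be inverse to \<open>\<langle>Fm (\<pi>1 A B), Fm (\<pi>2 A B)\<rangle>\<close>; one half of this
  is stated through its two components. Likewise \<open>m0\<close> is inverse to \<open>! (Fo \<top>)\<close>, where the other
  composite is an arrow \<open>\<top> \<rightarrow> \<top>\<close>, hence an identity.
\<close>

locale product_preserving_endofunctor = cartesian_category C + endofunctor C Fo Fm
  for C :: "('o, 'm, 'r) cart_cat_scheme" (structure)
    and Fo :: "'o \<Rightarrow> 'o" and Fm :: "'m \<Rightarrow> 'm"
    and m :: "'o \<Rightarrow> 'o \<Rightarrow> 'm" and m0 :: "'m" +
  assumes comparison_hom: "A \<in> Ob C \<Longrightarrow> B \<in> Ob C \<Longrightarrow> m A B \<in> hom C (Fo A \<otimes> Fo B) (Fo (A \<otimes> B))"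
    and map_pr1: "A \<in> Ob C \<Longrightarrow> B \<in> Ob C \<Longrightarrow> Fm (\<pi>1 A B) \<cdot> m A B = \<pi>1 (Fo A) (Fo B)"
    and map_pr2: "A \<in> Ob C \<Longrightarrow> B \<in> Ob C \<Longrightarrow> Fm (\<pi>2 A B) \<cdot> m A B = \<pi>2 (Fo A) (Fo B)"
    and comparison_inverse: "A \<in> Ob C \<Longrightarrow> B \<in> Ob C \<Longrightarrow>
          m A B \<cdot> \<langle>Fm (\<pi>1 A B), Fm (\<pi>2 A B)\<rangle> = \<one> (Fo (A \<otimes> B))"
    and comparison0_hom: "m0 \<in> hom C \<top> (Fo \<top>)"
    and comparison0_inverse: "m0 \<cdot> ! (Fo \<top>) = \<one> (Fo \<top>)"
begin

declare functor_Ob [simp] functor_id [simp]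

lemma functor_arrow [simp]:
  assumes "f \<in> Ar C"
  shows "Fm f \<in> Ar C" "dom C (Fm f) = Fo (dom C f)" "cod C (Fm f) = Fo (cod C f)"
  using functor_hom[of f "dom C f" "cod C f"] assms by (auto simp: hom_def)

lemma map_comp [simp]:
  "f \<in> Ar C \<Longrightarrow> g \<in> Ar C \<Longrightarrow> dom C g = cod C f \<Longrightarrow> Fm (g \<cdot> f) = Fm g \<cdot> Fm f"
  using functor_comp[of f "dom C f" "cod C f" g "cod C g"] by (auto simp: hom_def)

lemma comparison_arrow [simp]:
  assumes "A \<in> Ob C" "B \<in> Ob C"
  shows "m A B \<in> Ar C" "dom C (m A B) = Fo A \<otimes> Fo B" "cod C (m A B) = Fo (A \<otimes> B)"
  using comparison_hom[OF assms] by (auto simp: hom_def)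

lemma comparison0_arrow [simp]:
  shows "m0 \<in> Ar C" "dom C m0 = \<top>" "cod C m0 = Fo \<top>"
  using comparison0_hom by (auto simp: hom_def)

lemma map_pr_comp [simp]:
  assumes "A \<in> Ob C" "B \<in> Ob C"
  shows "Fm (\<pi>1 A B) \<cdot> m A B = \<pi>1 (Fo A) (Fo B)"
    and "Fm (\<pi>2 A B) \<cdot> m A B = \<pi>2 (Fo A) (Fo B)"
    and "h \<in> Ar C \<Longrightarrow> cod C h = Fo A \<otimes> Fo B \<Longrightarrow> Fm (\<pi>1 A B) \<cdot> (m A B \<cdot> h) = \<pi>1 (Fo A) (Fo B) \<cdot> h"
    and "h \<in> Ar C \<Longrightarrow> cod C h = Fo A \<otimes> Fo B \<Longrightarrow> Fm (\<pi>2 A B) \<cdot> (m A B \<cdot> h) = \<pi>2 (Fo A) (Fo B) \<cdot> h"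
  using assms map_pr1[OF assms] map_pr2[OF assms]
    comp_assoc_right[of h "m A B" "Fm (\<pi>1 A B)"] comp_assoc_right[of h "m A B" "Fm (\<pi>2 A B)"]
  by auto

lemma map_pair [simp]:
  assumes "f \<in> Ar C" "g \<in> Ar C" "dom C f = dom C g"
  shows "Fm \<langle>f, g\<rangle> = m (cod C f) (cod C g) \<cdot> \<langle>Fm f, Fm g\<rangle>"
proof -
  let ?A = "cod C f" and ?B = "cod C g"
  have Ob: "?A \<in> Ob C" "?B \<in> Ob C" using assms by auto
  have "Fm \<langle>f, g\<rangle> = (m ?A ?B \<cdot> \<langle>Fm (\<pi>1 ?A ?B), Fm (\<pi>2 ?A ?B)\<rangle>) \<cdot> Fm \<langle>f, g\<rangle>"
    using assms Ob by (simp only: comparison_inverse) simp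
  also have "\<dots> = m ?A ?B \<cdot> \<langle>Fm (\<pi>1 ?A ?B \<cdot> \<langle>f, g\<rangle>), Fm (\<pi>2 ?A ?B \<cdot> \<langle>f, g\<rangle>)\<rangle>"
    using assms Ob by (simp del: pr_pair)
  also have "\<dots> = m ?A ?B \<cdot> \<langle>Fm f, Fm g\<rangle>"
    using assms by simp
  finally show ?thesis .
qed

lemma comparison_inverse_arrows:
  assumes "A \<in> Ob C" "B \<in> Ob C"
  shows "inverse_arrows C (m A B) \<langle>Fm (\<pi>1 A B), Fm (\<pi>2 A B)\<rangle>"
  using assms by (simp add: inverse_arrows_def hom_def comparison_inverse)

text \<open>
  After the images of pairs and projections have been expressed through \<open>m\<close>, the coherence
  conditions become identities between tuples of projections.
\<close>

lemma symmetric_monoidal: "symmetric_monoidal_endofunctor C Fo Fm m m0"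
proof unfold_locales
  show "\<exists>n. inverse_arrows C m0 n"
    using comparison0_inverse
    by (intro exI[of _ "! (Fo \<top>)"]) (auto simp: inverse_arrows_def hom_def intro: to_top_eqI)
next
  fix f g A A' B B' assume "f \<in> hom C A A'" "g \<in> hom C B B'"
  then show "Fm (f \<boxtimes> g) \<cdot> m A B = m A' B' \<cdot> (Fm f \<boxtimes> Fm g)"
    by (auto simp: hom_def prd_map_def)
next
  fix X Y Z assume "X \<in> Ob C" "Y \<in> Ob C" "Z \<in> Ob C"
  then show "Fm (assoc C X Y Z) \<cdot> (m (X \<otimes> Y) Z \<cdot> (m X Y \<boxtimes> \<one> (Fo Z))) =
      m X (Y \<otimes> Z) \<cdot> ((\<one> (Fo X) \<boxtimes> m Y Z) \<cdot> assoc C (Fo X) (Fo Y) (Fo Z))"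
    by (simp add: assoc_def prd_map_def)
qed (auto simp: comparison_hom comparison0_hom prd_map_def symm_def
       intro: comparison_inverse_arrows)

end


section \<open>Traces and fixpoints\<close>

context parametrized_fixpoint_operator
begin

lemma fix_arrow [simp]:
  assumes "A \<in> Ob C" "X \<in> Ob C" "f \<in> Ar C" "dom C f = A \<otimes> X" "cod C f = X"
  shows "fx A X f \<in> Ar C" "dom C (fx A X f) = A" "cod C (fx A X f) = X"
  using fix_hom[of A X f] assms by (auto simp: hom_def)

text \<open>
  Write \<open>f = \<langle>f\<^sub>1, f\<^sub>2\<rangle>\<close>. The conjugate of \<open>Fm f\<close> has the components \<open>Fm f\<^sub>1 \<cdot> m A X\<close> and \<open>Fm f\<^sub>2 \<cdot> m A X\<close>, so its
  trace is \<open>Fm f\<^sub>1 \<cdot> m A X \<cdot> \<langle>\<one>, fix (Fm f\<^sub>2 \<cdot> m A X)\<rangle>\<close>, whereas \<open>Fm\<close> takes the trace of \<open>f\<close> to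
  \<open>Fm f\<^sub>1 \<cdot> m A X \<cdot> \<langle>\<one>, Fm (fix f\<^sub>2)\<rangle>\<close>. For the converse direction, \<open>fix f\<close> is the trace of \<open>\<langle>f, f\<rangle>\<close>.
\<close>

lemma preserves_trace_iff_preserves_fix:
  assumes "product_preserving_endofunctor C Fo Fm m m0"
  shows "(\<forall>A \<in> Ob C. \<forall>B \<in> Ob C. \<forall>X \<in> Ob C. \<forall>f \<in> hom C (A \<otimes> X) (B \<otimes> X).
           Fm (conway_trace C fx A B X f) =
           conway_trace C fx (Fo A) (Fo B) (Fo X)
             (\<langle>Fm (\<pi>1 B X), Fm (\<pi>2 B X)\<rangle> \<cdot> (Fm f \<cdot> m A X))) \<longleftrightarrow>
         (\<forall>A \<in> Ob C. \<forall>X \<in> Ob C. \<forall>f \<in> hom C (A \<otimes> X) X.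
           Fm (fx A X f) = fx (Fo A) (Fo X) (Fm f \<cdot> m A X))"
    (is "?trace \<longleftrightarrow> ?fix")
proof
  interpret product_preserving_endofunctor C Fo Fm m m0 by (fact assms)
  show ?trace if ?fix
  proof (intro ballI)
    fix A B X f
    assume Ob: "A \<in> Ob C" "B \<in> Ob C" "X \<in> Ob C" and f: "f \<in> hom C (A \<otimes> X) (B \<otimes> X)"
    have "Fm (fx A X (\<pi>2 B X \<cdot> f)) = fx (Fo A) (Fo X) (Fm (\<pi>2 B X \<cdot> f) \<cdot> m A X)"
      using that Ob f by (auto simp: hom_def)
    with Ob f show "Fm (conway_trace C fx A B X f) =
        conway_trace C fx (Fo A) (Fo B) (Fo X) (\<langle>Fm (\<pi>1 B X), Fm (\<pi>2 B X)\<rangle> \<cdot> (Fm f \<cdot> m A X))"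
      by (simp add: conway_trace_def hom_def)
  qed
  show ?fix if ?trace
  proof (intro ballI)
    fix A X f assume Ob: "A \<in> Ob C" "X \<in> Ob C" and f: "f \<in> hom C (A \<otimes> X) X"
    have "\<langle>f, f\<rangle> \<in> hom C (A \<otimes> X) (X \<otimes> X)" using f by (auto simp: hom_def)
    then have *: "Fm (conway_trace C fx A X X \<langle>f, f\<rangle>) =
        conway_trace C fx (Fo A) (Fo X) (Fo X)
          (\<langle>Fm (\<pi>1 X X), Fm (\<pi>2 X X)\<rangle> \<cdot> (Fm \<langle>f, f\<rangle> \<cdot> m A X))"
      using that Ob by blast
    have "conway_trace C fx A X X \<langle>f, f\<rangle> = fx A X f"
      using Ob f fixpoint[OF Ob f] by (simp add: conway_trace_def hom_def)
    moreover have "conway_trace C fx (Fo A) (Fo X) (Fo X)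
        (\<langle>Fm (\<pi>1 X X), Fm (\<pi>2 X X)\<rangle> \<cdot> (Fm \<langle>f, f\<rangle> \<cdot> m A X)) = fx (Fo A) (Fo X) (Fm f \<cdot> m A X)"
      using Ob f fixpoint[of "Fo A" "Fo X" "Fm f \<cdot> m A X"]
      by (simp add: conway_trace_def hom_def)
    ultimately show "Fm (fx A X f) = fx (Fo A) (Fo X) (Fm f \<cdot> m A X)"
      using * by simp
  qed
qed

end

context conway_operator
begin

text \<open>
  If the first equation of a system in \<open>X \<otimes> Y\<close> does not mention \<open>Y\<close>, the Bekic law solves it by
  itself. In other words, \<open>fx\<close> is uniform along first projections.
\<close>

lemma fix_triangular:
  assumes Ob: "A \<in> Ob C" "X \<in> Ob C" "Y \<in> Ob C"
    and f: "f \<in> hom C (A \<otimes> X) X"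
    and h: "h \<in> hom C (A \<otimes> (X \<otimes> Y)) (X \<otimes> Y)"
    and triangular: "\<pi>1 X Y \<cdot> h = f \<cdot> (\<one> A \<boxtimes> \<pi>1 X Y)"
  shows "\<pi>1 X Y \<cdot> fx A (X \<otimes> Y) h = fx A X f"
proof -
  define f' where "f' = f \<cdot> \<pi>1 (A \<otimes> X) Y"
  define g where "g = \<pi>2 X Y \<cdot> h \<cdot> assoc C A X Y"
  define l where "l = fx A X (f' \<cdot> \<langle>\<one> (A \<otimes> X), fx (A \<otimes> X) Y g\<rangle>)"
  have f': "f' \<in> hom C (A \<otimes> X \<otimes> Y) X" and g: "g \<in> hom C (A \<otimes> X \<otimes> Y) Y"
    using Ob f h by (auto simp: f'_def g_def assoc_def hom_def)
  have "h = \<langle>\<pi>1 X Y \<cdot> h, \<pi>2 X Y \<cdot> h\<rangle>"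
    using Ob h by (simp add: hom_def)
  also have "\<pi>1 X Y \<cdot> h = f' \<cdot> assoc_inv C A X Y"
    unfolding triangular using Ob f
    by (auto simp: f'_def prd_map_def assoc_inv_def hom_def)
  also have "\<pi>2 X Y \<cdot> h = g \<cdot> assoc_inv C A X Y"
    using Ob h by (auto simp: g_def assoc_def assoc_inv_def hom_def)
  also have "\<langle>f' \<cdot> assoc_inv C A X Y, g \<cdot> assoc_inv C A X Y\<rangle> = \<langle>f', g\<rangle> \<cdot> assoc_inv C A X Y"
    using Ob f' g by (subst pair_comp) (auto simp: assoc_inv_def hom_def)
  finally have "fx A (X \<otimes> Y) h = \<langle>l, fx A Y (g \<cdot> (\<langle>\<one> A, l\<rangle> \<boxtimes> \<one> Y))\<rangle>"
    using bekic[OF Ob f' g l_def] by simp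
  moreover have "l = fx A X f"
    using Ob f g by (simp add: l_def f'_def hom_def)
  ultimately show ?thesis
    using Ob f g by (simp add: hom_def prd_map_def)
qed

end


section \<open>The tangent functor\<close>

context cartesian_differential_category
begin

lemma D_arrow [simp]:
  assumes "f \<in> Ar C"
  shows "\<D> f \<in> Ar C" "dom C (\<D> f) = dom C f \<otimes> dom C f" "cod C (\<D> f) = cod C f"
  using D_hom[of f "dom C f" "cod C f"] assms by (auto simp: hom_def)

lemma D_comp:
  "f \<in> Ar C \<Longrightarrow> g \<in> Ar C \<Longrightarrow> dom C g = cod C f \<Longrightarrow>
     \<D> (g \<cdot> f) = \<D> g \<cdot> \<langle>f \<cdot> \<pi>1 (dom C f) (dom C f), \<D> f\<rangle>"
  using CD5[of f "dom C f" "cod C f" g "cod C g"] by (auto simp: hom_def)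

text \<open>
  The swap on the left of the conjugate \<open>c \<cdot> T f \<cdot> c\<close> is thus the inverse of the comparison, as the
  general theory of product-preserving functors requires. This is a reformulation of \<open>CD3_pr1\<close> and
  \<open>CD3_pr2\<close>.
\<close>

lemma swap_mid_eq_T_pr:
  assumes "A \<in> Ob C" "B \<in> Ob C"
  shows "swap_mid C A B A B = \<langle>T_map C (\<pi>1 A B), T_map C (\<pi>2 A B)\<rangle>"
  using assms by (simp add: swap_mid_def Let_def T_map_def CD3_pr1 CD3_pr2)

lemma T_product_preserving:
  "product_preserving_endofunctor C (T_ob C) (T_map C) (\<lambda>A B. swap_mid C A A B B) \<langle>! \<top>, ! \<top>\<rangle>"
proof unfold_locales
  show "\<langle>! \<top>, ! \<top>\<rangle> \<cdot> ! (T_ob C \<top>) = \<one> (T_ob C \<top>)"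
    by (rule product_eqI[of \<top> \<top> _ "\<top> \<otimes> \<top>"]) (auto simp: T_ob_def hom_def intro!: to_top_eqI)
qed (auto simp: T_ob_def T_map_def swap_mid_def Let_def hom_def
       D_comp CD3_id CD3_pr1 CD3_pr2)

text \<open>
  The components of \<open>T_map C (fx A X f)\<close> are \<open>fx A X f \<cdot> \<pi>1 A A\<close> and \<open>\<D> (fx A X f)\<close>. The first is
  always the first component of the fixpoint on the right, by \<open>fix_triangular\<close> and naturality.
\<close>

lemma T_fix_iff_differential_fixpoint:
  assumes "conway_operator C fx" and Ob: "A \<in> Ob C" "X \<in> Ob C" and f: "f \<in> hom C (A \<otimes> X) X"
  shows "T_map C (fx A X f) = fx (T_ob C A) (T_ob C X) (T_map C f \<cdot> swap_mid C A A X X) \<longleftrightarrow>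
         \<D> (fx A X f) = \<pi>2 X X \<cdot> fx (T_ob C A) (T_ob C X) (T_map C f \<cdot> swap_mid C A A X X)"
proof -
  interpret conway_operator C fx by (fact assms(1))
  define h where "h = T_map C f \<cdot> swap_mid C A A X X"
  have h: "h \<in> hom C (A \<otimes> A \<otimes> (X \<otimes> X)) (X \<otimes> X)"
    using Ob f by (simp add: h_def T_map_def swap_mid_def Let_def hom_def)
  have base: "\<pi>1 X X \<cdot> fx (A \<otimes> A) (X \<otimes> X) h = fx A X f \<cdot> \<pi>1 A A"
  proof -
    have "\<pi>1 X X \<cdot> fx (A \<otimes> A) (X \<otimes> X) h = fx (A \<otimes> A) X (f \<cdot> (\<pi>1 A A \<boxtimes> \<one> X))"
      using Ob f h
      by (intro fix_triangular)
        (auto simp: h_def T_map_def swap_mid_def Let_def prd_map_def hom_def)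
    also have "\<dots> = fx A X f \<cdot> \<pi>1 A A"
      using naturality[OF Ob(2) pr1_hom[OF Ob(1) Ob(1)] f] by simp
    finally show ?thesis .
  qed
  have "T_map C (fx A X f) = \<langle>\<pi>1 X X \<cdot> fx (A \<otimes> A) (X \<otimes> X) h, \<D> (fx A X f)\<rangle>"
    using Ob f by (simp add: T_map_def base hom_def)
  moreover have "fx (A \<otimes> A) (X \<otimes> X) h
      = \<langle>\<pi>1 X X \<cdot> fx (A \<otimes> A) (X \<otimes> X) h, \<pi>2 X X \<cdot> fx (A \<otimes> A) (X \<otimes> X) h\<rangle>"
    using Ob h by (simp add: hom_def)
  moreover have "\<pi>2 X X \<cdot> \<langle>\<pi>1 X X \<cdot> fx (A \<otimes> A) (X \<otimes> X) h, \<D> (fx A X f)\<rangle> = \<D> (fx A X f)"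
    using Ob f h by (simp add: hom_def)
  ultimately show ?thesis
    unfolding h_def[symmetric] T_ob_def by metis
qed

end


section \<open>The differential-fixpoint rule and the trace\<close>

theorem proposition4p6:
  fixes C :: "('o, 'm, 'r) diff_cat_scheme" (structure)
    and fx :: "'o \<Rightarrow> 'o \<Rightarrow> 'm \<Rightarrow> 'm"
  assumes "cartesian_differential_category C"
    and "conway_operator C fx"
  shows "(traced_cartesian_differential_category C fx \<longleftrightarrow>
           (\<forall>A \<in> Ob C. \<forall>B \<in> Ob C. \<forall>X \<in> Ob C. \<forall>f \<in> hom C (A \<otimes> X) (B \<otimes> X).
              T_map C (conway_trace C fx A B X f) =
              conway_trace C fx (T_ob C A) (T_ob C B) (T_ob C X)
                (swap_mid C B X B X \<cdot> T_map C f \<cdot> swap_mid C A A X X))) \<and>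
         (traced_cartesian_differential_category C fx \<longleftrightarrow>
           traced_monoidal_endofunctor C (conway_trace C fx)
             (T_ob C) (T_map C) (\<lambda>A B. swap_mid C A A B B) \<langle>! \<top>, ! \<top>\<rangle>)"
proof -
  interpret cartesian_differential_category C by (fact assms(1))
  interpret conway_operator C fx by (fact assms(2))
  let ?m = "\<lambda>A B. swap_mid C A A B B"
  interpret T: product_preserving_endofunctor C "T_ob C" "T_map C" ?m "\<langle>! \<top>, ! \<top>\<rangle>"
    by (rule T_product_preserving)
  define trace where "trace \<longleftrightarrow>
     (\<forall>A \<in> Ob C. \<forall>B \<in> Ob C. \<forall>X \<in> Ob C. \<forall>f \<in> hom C (A \<otimes> X) (B \<otimes> X).
        T_map C (conway_trace C fx A B X f) =
        conway_trace C fx (T_ob C A) (T_ob C B) (T_ob C X)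
          (\<langle>T_map C (\<pi>1 B X), T_map C (\<pi>2 B X)\<rangle> \<cdot> (T_map C f \<cdot> ?m A X)))"
  have "traced_cartesian_differential_category C fx \<longleftrightarrow>
      (\<forall>A \<in> Ob C. \<forall>X \<in> Ob C. \<forall>f \<in> hom C (A \<otimes> X) X.
        \<D> (fx A X f) = \<pi>2 X X \<cdot> fx (T_ob C A) (T_ob C X) (T_map C f \<cdot> ?m A X))"
    using assms by (auto simp: traced_cartesian_differential_category_def
        traced_cartesian_differential_category_axioms_def)
  also have "\<dots> \<longleftrightarrow> (\<forall>A \<in> Ob C. \<forall>X \<in> Ob C. \<forall>f \<in> hom C (A \<otimes> X) X.
      T_map C (fx A X f) = fx (T_ob C A) (T_ob C X) (T_map C f \<cdot> ?m A X))"
    using T_fix_iff_differential_fixpoint[OF assms(2)] by simp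
  also have "\<dots> \<longleftrightarrow> trace"
    unfolding trace_def by (rule preserves_trace_iff_preserves_fix[OF T_product_preserving, symmetric])
  finally have traced_iff: "traced_cartesian_differential_category C fx \<longleftrightarrow> trace" .
  have "swap_mid C B X B X \<cdot> T_map C f \<cdot> ?m A X =
      \<langle>T_map C (\<pi>1 B X), T_map C (\<pi>2 B X)\<rangle> \<cdot> (T_map C f \<cdot> ?m A X)"
    if "A \<in> Ob C" "B \<in> Ob C" "X \<in> Ob C" "f \<in> hom C (A \<otimes> X) (B \<otimes> X)" for A B X f
    unfolding swap_mid_eq_T_pr[OF that(2,3)] using that by (simp add: hom_def)
  then have trace_iff: "trace \<longleftrightarrow>
      (\<forall>A \<in> Ob C. \<forall>B \<in> Ob C. \<forall>X \<in> Ob C. \<forall>f \<in> hom C (A \<otimes> X) (B \<otimes> X).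
        T_map C (conway_trace C fx A B X f) =
        conway_trace C fx (T_ob C A) (T_ob C B) (T_ob C X)
          (swap_mid C B X B X \<cdot> T_map C f \<cdot> ?m A X))"
    unfolding trace_def by simp
  \<comment> \<open>The inverse of the comparison, universally quantified in \<open>preserves_trace\<close>, is unique.\<close>
  have "inverse_arrows C (?m B X) n \<longleftrightarrow> n = \<langle>T_map C (\<pi>1 B X), T_map C (\<pi>2 B X)\<rangle>"
    if "B \<in> Ob C" "X \<in> Ob C" for B X n
    using T.comparison_inverse_arrows[OF that] inverse_arrows_unique by blast
  then have "traced_monoidal_endofunctor C (conway_trace C fx) (T_ob C) (T_map C) ?m \<langle>! \<top>, ! \<top>\<rangle>
      \<longleftrightarrow> trace"
    using T.symmetric_monoidal unfolding trace_def
    by (auto simp: traced_monoidal_endofunctor_def traced_monoidal_endofunctor_axioms_def)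
  with traced_iff trace_iff show ?thesis by blast
qed

end
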